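(* Let $V$ be a rank one valuation domain with quotient field $K$ such that the set $\mathcal{W}$ of Ostrowski valuation domains $W_E$ associated to pseudo-convergent sequences $E\subset K$ is nonempty. The Zariski and the constructible topologies agree on $\mathcal{W}$ (regarded as a subset of $\mathrm{Zar}(K(X)|V)$). In particular, $\mathcal{W}$ is a zero-dimensional space.
   Context: $V$ has rank one, with valuation $v$ and value group regarded as a subgroup of $\mathbb{R}$. A sequence $E=\{s_n\}_{n\in\mathbb{N}}$ in $K$ is pseudo-convergent if $v(s_{n+1}-s_n)<v(s_{n+2}-s_{n+1})$ for all $n$. For $\phi\in K(X)$ let $w_E(\phi)=\lim_{n\to\infty}v(\phi(s_n))$; when $w_E$ is a valuation on $K(X)$, $W_E=\{\phi\in K(X)\mid w_E(\phi)\geq 0\}$ is its valuation domain. Set $$\mathcal{W}=\{W_E\mid E\subset K\text{ is a pseudo-convergent sequence and }w_E\text{ is a valuation}\}.$$ $\mathrm{Zar}(K(X)|V)$ is the set of valuation domains of $K(X)$ containing $V$. The Zariski topology on it is generated by the subbasic open sets $B(\phi)=\{Z\in\mathrm{Zar}(K(X)|V)\mid \phi\in Z\}$, $\phi\in K(X)$; the constructible topology is the coarsest topology in which all the sets $B(\phi_1,\ldots,\phi_k)=B(\phi_1)\cap\cdots\cap B(\phi_k)$ are both open and closed. Subsets carry the subspace topologies. A topological space is zero-dimensional if it is $T_1$ and each point has a neighborhood base consisting of open-closed sets. *)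

theory Defs
  imports "HOL-Analysis.Analysis" "HOL-Computational_Algebra.Fraction_Field"
    "HOL-Computational_Algebra.Polynomial"
begin

definition real_valuation :: "('k::field \<Rightarrow> ereal) \<Rightarrow> bool" where
  "real_valuation v \<longleftrightarrow>
     (\<forall>x. v x \<noteq> -\<infinity>) \<and>
     (\<forall>x. v x = \<infinity> \<longleftrightarrow> x = 0) \<and>
     (\<forall>x y. v (x * y) = v x + v y) \<and>
     (\<forall>x y. min (v x) (v y) \<le> v (x + y))"

text \<open>A valuation ring has rank one iff its value group is isomorphic, as an ordered group, to a
  nonzero subgroup of the reals; the valuation is taken with such an embedding fixed.\<close>

definition rank_one_valuation :: "('k::field \<Rightarrow> ereal) \<Rightarrow> bool" where
  "rank_one_valuation v \<longleftrightarrow> real_valuation v \<and> (\<exists>x. x \<noteq> 0 \<and> v x \<noteq> 0)"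

definition valuation_ring :: "('k::field \<Rightarrow> ereal) \<Rightarrow> 'k set" where
  "valuation_ring v = {x. 0 \<le> v x}"

definition valuation_domain_of :: "'k::field set \<Rightarrow> bool" where
  "valuation_domain_of Z \<longleftrightarrow>
     1 \<in> Z \<and> (\<forall>x\<in>Z. \<forall>y\<in>Z. x - y \<in> Z \<and> x * y \<in> Z) \<and>
     (\<forall>x. x \<noteq> 0 \<longrightarrow> x \<in> Z \<or> inverse x \<in> Z)"

text \<open>The field of rational functions over \<open>'k\<close> is \<open>'k poly fract\<close>. The value at a pole is a
  dummy: the terms of a pseudo-convergent sequence are pairwise distinct, so only finitely many of
  them are poles of a given rational function, and limits along the sequence ignore them.\<close>

definition rat_eval :: "'k::field poly fract \<Rightarrow> 'k \<Rightarrow> 'k" where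
  "rat_eval \<phi> a =
     (if \<exists>p q. \<phi> = Fract p q \<and> poly q a \<noteq> 0
      then (THE y. \<exists>p q. \<phi> = Fract p q \<and> poly q a \<noteq> 0 \<and> y = poly p a / poly q a)
      else 0)"

definition pseudo_convergent :: "('k::field \<Rightarrow> ereal) \<Rightarrow> (nat \<Rightarrow> 'k) \<Rightarrow> bool" where
  "pseudo_convergent v s \<longleftrightarrow>
     (\<forall>n. v (s (n + 1) - s n) < v (s (n + 2) - s (n + 1)))"

definition seq_valuation ::
  "('k::field \<Rightarrow> ereal) \<Rightarrow> (nat \<Rightarrow> 'k) \<Rightarrow> 'k poly fract \<Rightarrow> ereal" where
  "seq_valuation v s \<phi> = lim (\<lambda>n. v (rat_eval \<phi> (s n)))"

definition Ostrowski_domains :: "('k::field \<Rightarrow> ereal) \<Rightarrow> 'k poly fract set set" where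
  "Ostrowski_domains v =
     {valuation_ring (seq_valuation v s) |s.
        pseudo_convergent v s \<and> real_valuation (seq_valuation v s)}"

definition Zar :: "'k::field set \<Rightarrow> 'k poly fract set set" where
  "Zar V = {Z. valuation_domain_of Z \<and> (\<lambda>a. Fract [:a:] 1) ` V \<subseteq> Z}"

definition Zar_basic :: "'k::field set \<Rightarrow> 'k poly fract set \<Rightarrow> 'k poly fract set set" where
  "Zar_basic V F = {Z \<in> Zar V. F \<subseteq> Z}"

definition Zariski_topology :: "'k::field set \<Rightarrow> 'k poly fract set topology" where
  "Zariski_topology V = topology_generated_by (range (\<lambda>\<phi>. Zar_basic V {\<phi>}))"

definition constructible_topology :: "'k::field set \<Rightarrow> 'k poly fract set topology" where
  "constructible_topology V =
     topology_generated_by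
       ({Zar_basic V F |F. finite F \<and> F \<noteq> {}} \<union> {Zar V - Zar_basic V F |F. finite F \<and> F \<noteq> {}})"

lemma topspace_Zariski_topology [simp]: "topspace (Zariski_topology V) = Zar V"
proof -
  have "Zar_basic V {1} = Zar V"
    by (auto simp: Zar_basic_def Zar_def valuation_domain_of_def)
  then show ?thesis
    unfolding Zariski_topology_def topology_generated_by_topspace by (fastforce simp: Zar_basic_def)
qed

lemma topspace_constructible_topology [simp]: "topspace (constructible_topology V) = Zar V"
proof -
  have "Zar_basic V {1} \<union> (Zar V - Zar_basic V {1}) = Zar V"
    by (auto simp: Zar_basic_def)
  then show ?thesis
    unfolding constructible_topology_def topology_generated_by_topspace
    by (auto simp: Zar_basic_def)
qed

lemma constructible_topology_clopen:
  assumes "finite F" "F \<noteq> {}"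
  shows "openin (constructible_topology V) (Zar_basic V F)"
    and "closedin (constructible_topology V) (Zar_basic V F)"
proof -
  show "openin (constructible_topology V) (Zar_basic V F)"
    unfolding constructible_topology_def using assms by (intro topology_generated_by_Basis) auto
  have "openin (constructible_topology V) (Zar V - Zar_basic V F)"
    unfolding constructible_topology_def using assms by (intro topology_generated_by_Basis) auto
  then show "closedin (constructible_topology V) (Zar_basic V F)"
    by (auto simp: closedin_def Zar_basic_def)
qed

lemma constructible_topology_coarsest:
  assumes "topspace T = Zar V"
    and "\<And>F. finite F \<Longrightarrow> F \<noteq> {} \<Longrightarrow> openin T (Zar_basic V F) \<and> closedin T (Zar_basic V F)"
    and "openin (constructible_topology V) U"
  shows "openin T U"
proof -
  have "openin T S"
    if "S \<in> {Zar_basic V F |F. finite F \<and> F \<noteq> {}} \<union> {Zar V - Zar_basic V F |F. finite F \<and> F \<noteq> {}}"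
    for S
    using that assms(1,2) by (auto simp: closedin_def)
  then show ?thesis
    using assms(3) generate_topology_on_coarsest[OF istopology_openin]
    unfolding constructible_topology_def openin_topology_generated_by_iff by blast
qed

definition zero_dimensional_space :: "'x topology \<Rightarrow> bool" where
  "zero_dimensional_space X \<longleftrightarrow>
     t1_space X \<and> neighbourhood_base_of (\<lambda>C. openin X C \<and> closedin X C) X"

end

theory Submission
  imports Defs
begin

text \<open>All the \<open>W\<^sub>E\<close> are valuation domains of real valuations \<open>w\<^sub>E\<close> extending \<open>v\<close>. Fix \<open>c \<in> K\<close> with
  \<open>v(c) > 0\<close>. If \<open>w\<^sub>E(\<phi>) < 0\<close>, then by the Archimedean property \<open>w\<^sub>E(\<phi>\<^sup>-\<^sup>n) \<ge> v(c)\<close> for some \<open>n\<close>,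
  that is \<open>\<phi>\<^sup>-\<^sup>n / c \<in> W\<^sub>E\<close>; and the latter conversely forces \<open>w\<^sub>E(\<phi>) < 0\<close>. Hence on \<open>\<W>\<close> the
  complement of \<open>B(\<phi>)\<close> is the union of the Zariski-open sets \<open>B(\<phi>\<^sup>-\<^sup>n / c)\<close>, so that every \<open>B(\<phi>)\<close>
  is clopen.\<close>

section \<open>Real valuations and the Archimedean criterion for negative value\<close>

lemma real_valuation_mult: "real_valuation w \<Longrightarrow> w (x * y) = w x + w y"
  by (simp add: real_valuation_def)

lemma real_valuation_finite:
  assumes "real_valuation w" "x \<noteq> 0"
  obtains r where "w x = ereal r"
  using assms by (cases "w x") (auto simp: real_valuation_def)

lemma real_valuation_one:
  assumes "real_valuation w"
  shows "w 1 = 0"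
proof -
  obtain r where "w 1 = ereal r"
    \<comment> \<open>In \<open>ereal\<close> the equation a = a + a also has infinite solutions, so
      the value is first known to be a real number.\<close>
    using real_valuation_finite[OF assms, of 1] by auto
  then show ?thesis
    using real_valuation_mult[OF assms, of 1 1] by (simp add: zero_ereal_def)
qed

lemma real_valuation_inverse:
  assumes "real_valuation w" "x \<noteq> 0"
  shows "w (inverse x) = - w x"
proof -
  obtain r s where "w x = ereal r" "w (inverse x) = ereal s"
    using real_valuation_finite[OF assms] real_valuation_finite[OF assms(1), of "inverse x"] assms(2)
    by (metis inverse_nonzero_iff_nonzero)
  moreover have "w x + w (inverse x) = 0"
    using real_valuation_mult[OF assms(1), of x "inverse x"] real_valuation_one[OF assms(1)] assms(2)
    by simp
  ultimately show ?thesis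
    by simp
qed

lemma real_valuation_power:
  assumes "real_valuation w" "w x = ereal r"
  shows "w (x ^ n) = ereal (real n * r)"
  by (induction n)
    (simp_all add: assms real_valuation_one real_valuation_mult algebra_simps zero_ereal_def)

lemma real_valuation_neg_iff:
  assumes w: "real_valuation w" and c: "0 < w c" "c \<noteq> 0" and x: "x \<noteq> 0"
  shows "w x < 0 \<longleftrightarrow> (\<exists>n. 0 \<le> w (inverse x ^ n / c))"
proof -
  obtain r where r: "w x = ereal r"
    using real_valuation_finite[OF w x] .
  obtain g where g: "w c = ereal g"
    using real_valuation_finite[OF w c(2)] .
  have "w (inverse x) = ereal (- r)"
    using real_valuation_inverse[OF w x] r by simp
  then have "w (inverse x ^ n / c) = ereal (- (real n * r) - g)" for n
    using real_valuation_power[OF w] real_valuation_inverse[OF w c(2)]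
    by (simp add: divide_inverse real_valuation_mult[OF w] g)
  moreover have "r < 0 \<longleftrightarrow> (\<exists>n. 0 \<le> - (real n * r) - g)"
  proof
    assume "r < 0"
    then obtain n where "g < real n * - r"
      using reals_Archimedean3[of "- r"] by auto
    then have "0 \<le> - (real n * r) - g"
      by simp
    then show "\<exists>n. 0 \<le> - (real n * r) - g" ..
  next
    assume "\<exists>n. 0 \<le> - (real n * r) - g"
    then obtain n where "0 \<le> - (real n * r) - g" ..
    \<comment> \<open>Here \<open>g > 0\<close> makes the inequality strict; this excludes
      \<open>n = 0\<close> and leaves a negative \<open>r\<close> as the only possibility.\<close>
    then have "real n * r < 0"
      using c(1) g by simp
    then show "r < 0"
      by (simp add: mult_less_0_iff)
  qed
  ultimately show ?thesis
    by (simp add: r)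
qed

lemma rank_one_valuation_pos:
  assumes "rank_one_valuation v"
  obtains c where "c \<noteq> 0" "0 < v c"
proof -
  obtain x where v: "real_valuation v" and x: "x \<noteq> 0" "v x \<noteq> 0"
    using assms by (auto simp: rank_one_valuation_def)
  have "0 < v x \<or> 0 < v (inverse x)"
    using real_valuation_inverse[OF v x(1)] x(2) by (auto simp: neq_iff)
  then show thesis
    using that[of x] that[of "inverse x"] x(1) by auto
qed

section \<open>Constants under the limit valuations, and non-membership in the Ostrowski
  domains\<close>

lemma rat_eval_const: "rat_eval (Fract [:c:] 1) a = c"
proof -
  have "(THE y. \<exists>p q. Fract [:c:] 1 = Fract p q \<and> poly q a \<noteq> 0 \<and> y = poly p a / poly q a) = c"
  proof (rule the_equality)
    show "\<exists>p q. Fract [:c:] 1 = Fract p q \<and> poly q a \<noteq> 0 \<and> c = poly p a / poly q a"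
      by (rule exI[of _ "[:c:]"], rule exI[of _ 1]) simp
  next
    fix y
    assume "\<exists>p q. Fract [:c:] 1 = Fract p q \<and> poly q a \<noteq> 0 \<and> y = poly p a / poly q a"
    then obtain p q where pq: "Fract [:c:] 1 = Fract p q" "poly q a \<noteq> 0" "y = poly p a / poly q a"
      by blast
    then have "q \<noteq> 0"
      by auto
    \<comment> \<open>The description in \<open>rat_eval\<close> ranges over all fractions
      representing the constant; clearing denominators shows that each of them gives the same
      value.\<close>
    then have "[:c:] * q = p"
      using pq(1) by (simp add: eq_fract)
    then have "poly p a = c * poly q a"
      by auto
    then show "y = c"
      using pq(2,3) by simp
  qed
  moreover have "\<exists>p q. Fract [:c:] 1 = Fract p q \<and> poly q a \<noteq> 0"
    by (rule exI[of _ "[:c:]"], rule exI[of _ 1]) simp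
  ultimately show ?thesis
    by (simp only: rat_eval_def if_True)
qed

text \<open>The values along the sequence are constant, so w_E extends v. A single c with v(c) > 0
  therefore has positive value under every w_E.\<close>

lemma seq_valuation_const: "seq_valuation v s (Fract [:c:] 1) = v c"
  by (simp add: seq_valuation_def rat_eval_const limI)

text \<open>The elements tested on the right depend on c and \<open>\<phi>\<close> but not on the
  sequence behind \<open>Z\<close>. This uniformity is what turns the complement of a subbasic set
  into one union of subbasic sets.\<close>

lemma Ostrowski_domain_notin_iff:
  assumes "Z \<in> Ostrowski_domains v" "c \<noteq> 0" "0 < v c" "\<phi> \<noteq> 0"
  shows "\<phi> \<notin> Z \<longleftrightarrow> (\<exists>n. inverse \<phi> ^ n / Fract [:c:] 1 \<in> Z)"
proof -
  obtain s where Z: "Z = valuation_ring (seq_valuation v s)"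
    and w: "real_valuation (seq_valuation v s)"
    using assms(1) by (auto simp: Ostrowski_domains_def)
  have "Fract [:c:] 1 \<noteq> 0"
    using assms(2) by (simp add: Zero_fract_def eq_fract)
  then show ?thesis
    using real_valuation_neg_iff[OF w, of "Fract [:c:] 1" \<phi>] assms(3,4)
    by (simp add: Z valuation_ring_def seq_valuation_const not_le)
qed

section \<open>Clopen traces of the basic sets on the Ostrowski domains\<close>

lemma real_valuation_zero: "real_valuation w \<Longrightarrow> w 0 = \<infinity>"
  by (simp add: real_valuation_def)

lemma zero_in_Ostrowski_domain: "Z \<in> Ostrowski_domains v \<Longrightarrow> 0 \<in> Z"
  by (auto simp: Ostrowski_domains_def valuation_ring_def real_valuation_zero)

lemma openin_Zariski_basic: "openin (Zariski_topology V) (Zar_basic V {\<phi>})"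
  unfolding Zariski_topology_def by (intro topology_generated_by_Basis) auto

lemma openin_Ostrowski_diff_Zar_basic:
  fixes v :: "'k::field \<Rightarrow> ereal"
  assumes "rank_one_valuation v"
  shows "openin (subtopology (Zariski_topology V) (Ostrowski_domains v))
           (Ostrowski_domains v \<inter> (Zar V - Zar_basic V {\<phi>}))"
proof (cases "\<phi> = 0")
  \<comment> \<open>The criterion fails at 0: since \<open>inverse 0 = 0\<close>, both 0 and its
    powers with positive exponent divided by c lie in \<open>Z\<close>. But 0 lies in every domain,
    so nothing has to be covered.\<close>
  case True
  then have "Ostrowski_domains v \<inter> (Zar V - Zar_basic V {\<phi>}) = {}"
    by (auto simp: Zar_basic_def zero_in_Ostrowski_domain)
  then show ?thesis
    by simp
next
  case False
  obtain c where c: "c \<noteq> 0" "0 < v c"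
    using rank_one_valuation_pos[OF assms] .
  let ?U = "\<Union>n. Zar_basic V {inverse \<phi> ^ n / Fract [:c:] 1}"
  have "Ostrowski_domains v \<inter> (Zar V - Zar_basic V {\<phi>}) = Ostrowski_domains v \<inter> ?U"
  proof (rule set_eqI)
    fix Z
    show "Z \<in> Ostrowski_domains v \<inter> (Zar V - Zar_basic V {\<phi>}) \<longleftrightarrow> Z \<in> Ostrowski_domains v \<inter> ?U"
    proof (cases "Z \<in> Ostrowski_domains v")
      case True
      then show ?thesis
        using Ostrowski_domain_notin_iff[OF True c False] by (auto simp: Zar_basic_def)
    qed simp
  qed
  moreover have "openin (Zariski_topology V) ?U"
    by (intro openin_Union) (auto simp: openin_Zariski_basic)
  ultimately show ?thesis
    by (simp add: openin_subtopology_Int2)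
qed

lemma clopenin_Ostrowski_Zar_basic:
  fixes v :: "'k::field \<Rightarrow> ereal" and V :: "'k set"
  assumes "rank_one_valuation v" "finite F"
  defines "X \<equiv> subtopology (Zariski_topology V) (Ostrowski_domains v)"
  shows "openin X (Ostrowski_domains v \<inter> Zar_basic V F) \<and>
         closedin X (Ostrowski_domains v \<inter> Zar_basic V F)"
  using assms(2)
proof (induction F rule: finite_induct)
  case empty
  \<comment> \<open>No condition is imposed by the empty set, so the induction starts from the whole
    space.\<close>
  have "Ostrowski_domains v \<inter> Zar_basic V {} = topspace X"
    by (auto simp: X_def Zar_basic_def)
  then show ?case
    by (simp only: openin_topspace closedin_topspace)
next
  case (insert \<phi> F)
  let ?W = "Ostrowski_domains v"
  have "topspace X - ?W \<inter> Zar_basic V {\<phi>} = ?W \<inter> (Zar V - Zar_basic V {\<phi>})"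
    by (auto simp: X_def)
  moreover have "?W \<inter> Zar_basic V {\<phi>} \<subseteq> topspace X"
    by (auto simp: X_def Zar_basic_def)
  ultimately have "closedin X (?W \<inter> Zar_basic V {\<phi>})"
    using openin_Ostrowski_diff_Zar_basic[OF assms(1)] by (simp add: closedin_def X_def)
  moreover have "openin X (?W \<inter> Zar_basic V {\<phi>})"
    unfolding X_def by (intro openin_subtopology_Int2 openin_Zariski_basic)
  moreover have "?W \<inter> Zar_basic V (insert \<phi> F) =
      (?W \<inter> Zar_basic V {\<phi>}) \<inter> (?W \<inter> Zar_basic V F)"
    by (auto simp: Zar_basic_def)
  ultimately show ?case
    using insert.IH by (simp only: openin_Int closedin_Int)
qed

section \<open>Topologies generated by a subbase\<close>

lemma openin_Int_generated_by:
  assumes "openin (topology_generated_by S) U" "A \<subseteq> topspace X"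
    and "\<And>B. B \<in> S \<Longrightarrow> openin X (A \<inter> B)"
  shows "openin X (A \<inter> U)"
proof -
  have "generate_topology_on S U"
    using assms(1) by (simp add: openin_topology_generated_by_iff)
  \<comment> \<open>Intersecting with \<open>A\<close> commutes with finite intersections and
    arbitrary unions, so openness is inherited from the generators. The set \<open>A\<close> allows
    the two topologies to have different underlying sets.\<close>
  then show ?thesis
  proof induction
    case (Int a b)
    have "A \<inter> (a \<inter> b) = (A \<inter> a) \<inter> (A \<inter> b)"
      by blast
    then show ?case
      using Int.IH by (simp only: openin_Int)
  next
    case (UN K)
    have "openin X (\<Union>k\<in>K. A \<inter> k)"
      by (rule openin_Union) (use UN.IH in blast)
    then show ?case
      by (simp only: Int_Union)
  qed (simp_all add: assms(3))
qed

text \<open>Finite intersections of clopen sets are clopen, but unions need not be. The induction is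
  therefore on the claim about a point: in a union it is enough to stay inside one member containing
  \<open>x\<close>.\<close>

lemma neighbourhood_base_of_clopen_subbase:
  fixes A :: "'x set" and S :: "'x set set"
  defines "X \<equiv> subtopology (topology_generated_by S) A"
  assumes clopen: "\<And>B. B \<in> S \<Longrightarrow> closedin X (A \<inter> B)"
  shows "neighbourhood_base_of (\<lambda>C. openin X C \<and> closedin X C) X"
proof -
  have "\<exists>C. (openin X C \<and> closedin X C) \<and> x \<in> C \<and> C \<subseteq> U"
    if U: "openin X U" "x \<in> U" for U x
  proof -
    obtain T where T: "openin (topology_generated_by S) T" "U = T \<inter> A"
      using U(1) by (auto simp: X_def openin_subtopology)
    then have "generate_topology_on S T"
      by (simp add: openin_topology_generated_by_iff)
    then have "x \<in> T \<inter> A \<Longrightarrow> \<exists>C. (openin X C \<and> closedin X C) \<and> x \<in> C \<and> C \<subseteq> T \<inter> A"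
    proof induction
      case (Int a b)
      then obtain C D where "openin X C" "closedin X C" "x \<in> C" "C \<subseteq> a \<inter> A"
        "openin X D" "closedin X D" "x \<in> D" "D \<subseteq> b \<inter> A"
        by blast
      then show ?case
        by (intro exI[of _ "C \<inter> D"]) auto
    next
      case (UN K)
      then obtain k where "k \<in> K" "x \<in> k \<inter> A"
        by blast
      then obtain C where "openin X C" "closedin X C" "x \<in> C" "C \<subseteq> k \<inter> A"
        using UN.IH by blast
      then show ?case
        using \<open>k \<in> K\<close> by blast
    next
      case (Basis B)
      then have "openin X (A \<inter> B)"
        unfolding X_def by (intro openin_subtopology_Int2 topology_generated_by_Basis)
      then show ?case
        using Basis clopen by (intro exI[of _ "A \<inter> B"]) auto
    qed simp
    then show ?thesis
      using T(2) U(2) by blast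
  qed
  then show ?thesis
    by (subst open_neighbourhood_base_of) auto
qed

section \<open>Comparison of the two topologies and zero-dimensionality\<close>

theorem proposition6p3:
  fixes V :: "'k::field set" and v :: "'k \<Rightarrow> ereal"
  assumes "rank_one_valuation v"
    and "V = valuation_ring v"
    and "Ostrowski_domains v \<noteq> {}"
  shows "subtopology (Zariski_topology V) (Ostrowski_domains v)
       = subtopology (constructible_topology V) (Ostrowski_domains v)
     \<and> zero_dimensional_space (subtopology (Zariski_topology V) (Ostrowski_domains v))"
proof
  let ?W = "Ostrowski_domains v"
  let ?Z = "subtopology (Zariski_topology V) ?W"
  let ?C = "subtopology (constructible_topology V) ?W"
  note clopen = clopenin_Ostrowski_Zar_basic[OF assms(1)]
  have Z_le_C: "openin ?C U" if U: "openin ?Z U" for U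
  proof -
    obtain T where T: "openin (Zariski_topology V) T" "U = T \<inter> ?W"
      using U by (auto simp: openin_subtopology)
    have "openin (constructible_topology V) (Zar V \<inter> T)"
      using T(1)[unfolded Zariski_topology_def]
    proof (rule openin_Int_generated_by)
      fix B assume "B \<in> range (\<lambda>\<phi>. Zar_basic V {\<phi>})"
      then obtain \<phi> where "B = Zar_basic V {\<phi>}"
        by blast
      moreover have "Zar V \<inter> Zar_basic V {\<phi>} = Zar_basic V {\<phi>}"
        by (auto simp: Zar_basic_def)
      ultimately show "openin (constructible_topology V) (Zar V \<inter> B)"
        by (simp add: constructible_topology_clopen)
    qed simp
    moreover have "Zar V \<inter> T = T"
      using openin_subset[OF T(1)] by auto
    ultimately show ?thesis
      using T(2) unfolding openin_subtopology by auto
  qed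
  have C_le_Z: "openin ?Z U" if U: "openin ?C U" for U
  proof -
    obtain T where T: "openin (constructible_topology V) T" "U = T \<inter> ?W"
      using U by (auto simp: openin_subtopology)
    \<comment> \<open>The underlying set of \<open>?Z\<close> is \<open>Zar V \<inter> ?W\<close>;
      inside it the two kinds of generators become a clopen set and its complement.\<close>
    have "openin ?Z ((Zar V \<inter> ?W) \<inter> T)"
      using T(1)[unfolded constructible_topology_def]
    proof (rule openin_Int_generated_by)
      fix B
      assume "B \<in> {Zar_basic V F |F. finite F \<and> F \<noteq> {}} \<union> {Zar V - Zar_basic V F |F. finite F \<and> F \<noteq> {}}"
      then obtain F where F: "finite F" "B = Zar_basic V F \<or> B = Zar V - Zar_basic V F"
        by blast
      have "(Zar V \<inter> ?W) \<inter> Zar_basic V F = ?W \<inter> Zar_basic V F"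
        "(Zar V \<inter> ?W) \<inter> (Zar V - Zar_basic V F) = topspace ?Z - ?W \<inter> Zar_basic V F"
        by (auto simp: Zar_basic_def)
      then show "openin ?Z ((Zar V \<inter> ?W) \<inter> B)"
        using F clopen[OF F(1)] by (metis openin_diff openin_topspace)
    qed simp
    moreover have "(Zar V \<inter> ?W) \<inter> T = U"
      using openin_subset[OF T(1)] T(2) by auto
    ultimately show ?thesis
      by simp
  qed
  show "?Z = ?C"
    unfolding topology_eq using Z_le_C C_le_Z by blast
  have "t1_space ?Z"
    unfolding t1_space_def
  proof (intro ballI impI)
    fix Y Y' assume Y: "Y \<in> topspace ?Z" "Y' \<in> topspace ?Z" "Y \<noteq> Y'"
    \<comment> \<open>It is not known which of the two rings contains \<open>\<phi>\<close>.
      Openness of B(\<open>\<phi>\<close>) separates them in one case, its closedness in the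
      other.\<close>
    then obtain \<phi> where "\<phi> \<in> Y \<longleftrightarrow> \<phi> \<notin> Y'"
      by blast
    moreover have "openin ?Z (?W \<inter> Zar_basic V {\<phi>})"
      "openin ?Z (topspace ?Z - ?W \<inter> Zar_basic V {\<phi>})"
      using clopen[of "{\<phi>}"] by (simp_all only: finite.intros closedin_def)
    moreover have "X \<in> ?W \<inter> Zar_basic V {\<phi>} \<longleftrightarrow> \<phi> \<in> X" if "X \<in> topspace ?Z" for X
      using that by (auto simp: Zar_basic_def)
    ultimately show "\<exists>U. openin ?Z U \<and> Y \<in> U \<and> Y' \<notin> U"
      using Y(1,2) by (metis DiffE DiffI)
  qed
  moreover have "neighbourhood_base_of (\<lambda>C. openin ?Z C \<and> closedin ?Z C) ?Z"
    unfolding Zariski_topology_def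
  proof (rule neighbourhood_base_of_clopen_subbase)
    fix B assume "B \<in> range (\<lambda>\<phi>. Zar_basic V {\<phi>})"
    then obtain \<phi> where "B = Zar_basic V {\<phi>}"
      by blast
    then show "closedin (subtopology (topology_generated_by (range (\<lambda>\<phi>. Zar_basic V {\<phi>}))) ?W) (?W \<inter> B)"
      using clopen[of "{\<phi>}" V] by (simp only: Zariski_topology_def finite.intros)
  qed
  ultimately show "zero_dimensional_space ?Z"
    by (simp add: zero_dimensional_space_def)
qed

end
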